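(* Let $\mathfrak{A}$ be a residuated lattice, $F$ a filter of $\mathfrak{A}$ and $n\geq 1$ an integer. The following assertions are equivalent: (1) for any $n+1$ distinct $F$-minimal prime filters $\mathfrak{m}_{0},\ldots,\mathfrak{m}_{n}$, $\veebar_{i=0}^{n}\mathfrak{m}_{i}=A$; (2) $\mathfrak{A}$ is $n$-normal with respect to $F$; (3) for any prime filter $P$ containing $F$, $D_{F}(P)$ is an $(n+1)$-prime filter; (4) for any $x_0,\ldots,x_n\in A$ which are pairwise in $F$, $\veebar_{i=0}^{n}(F:x_{i})=A$; (5) for any $x_0,\ldots,x_n\in A$ which are pairwise in $F$, there exist $a_i\in (F:x_i)$ for $0\leq i\leq n$ such that $a_0\odot a_1\odot\cdots\odot a_n=0$; (6) for any $x_0,\ldots,x_n\in A$, $\left(F:\bigvee_{i=0}^{n} x_{i}\right)=\veebar_{i=0}^{n}\left(F:\bigvee_{0\le j\le n,\ j\neq i}x_{j}\right)$; (7) for any $x_0,\ldots,x_n\in A$, $\bigvee_{i=0}^{n} x_{i}\in F$ implies $\veebar_{i=0}^{n}\left(F:\bigvee_{0\le j\le n,\ j\neq i}x_{j}\right)=A$.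
   Context: A residuated lattice is an algebra $\mathfrak{A}=(A;\vee,\wedge,\odot,\rightarrow,0,1)$ such that $(A;\vee,\wedge,0,1)$ is a bounded lattice, $(A;\odot,1)$ is a commutative monoid, and $x\odot y\leq z$ iff $x\leq y\rightarrow z$ for all $x,y,z\in A$. A filter of $\mathfrak{A}$ is a non-empty subset $F\subseteq A$ such that $x,y\in F$ implies $x\odot y\in F$, and $x\in F$, $y\in A$ implies $x\vee y\in F$; it is proper if $F\neq A$. $\veebar$ denotes the join of filters, i.e. the filter generated by the union. A proper filter $P$ is prime if $x\vee y\in P$ implies $x\in P$ or $y\in P$. An $F$-minimal prime filter is a minimal element (under inclusion) of the set of prime filters containing $F$. For $x\in A$, $(F:x)=\{a\in A\mid x\vee a\in F\}$. For a proper filter $H$, $D_F(H)=\{a\in A\mid x\vee a\in F\text{ for some }x\in A\setminus H\}$. Elements $x_0,\ldots,x_n$ are pairwise in $F$ if $x_i\vee x_j\in F$ for all $i\neq j$. For $m\ge 2$, a proper filter $Q$ is $m$-prime if for any $x_1,\ldots,x_m\in A$ which are pairwise in $Q$ there exists $k$ with $x_k\in Q$ (equivalently, $Q$ is an intersection of at most $m-1$ distinct prime filters). $\mathfrak{A}$ is $n$-normal with respect to $F$ if every prime filter containing $F$ contains at most $n$ $F$-minimal prime filters. *)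

theory Defs
  imports Complex_Main
begin

text \<open>
  The algebra lives on a whole type: join, meet, 0 and 1 are \<open>sup\<close>, \<open>inf\<close>, \<open>bot\<close> and \<open>top\<close>,
  and the monoid operation is \<open>*\<close>. The unit of the monoid is written \<open>1\<close> by the library
  and is identified with \<open>top\<close>.
\<close>

class residuated_lattice = bounded_lattice + comm_monoid_mult +
  fixes residuum :: "'a \<Rightarrow> 'a \<Rightarrow> 'a"
  assumes one_eq_top: "1 = top"
    and residuation: "x * y \<le> z \<longleftrightarrow> x \<le> residuum y z"

definition rl_filter :: "'a::residuated_lattice set \<Rightarrow> bool" where
  "rl_filter F \<longleftrightarrow> F \<noteq> {} \<and> (\<forall>x\<in>F. \<forall>y\<in>F. x * y \<in> F) \<and> (\<forall>x\<in>F. \<forall>y. sup x y \<in> F)"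

definition proper_filter :: "'a::residuated_lattice set \<Rightarrow> bool" where
  "proper_filter F \<longleftrightarrow> rl_filter F \<and> F \<noteq> UNIV"

definition filter_join :: "'a::residuated_lattice set set \<Rightarrow> 'a set" where
  "filter_join \<F> = rl_filter hull (\<Union>\<F>)"

definition prime_filter :: "'a::residuated_lattice set \<Rightarrow> bool" where
  "prime_filter P \<longleftrightarrow> proper_filter P \<and> (\<forall>x y. sup x y \<in> P \<longrightarrow> x \<in> P \<or> y \<in> P)"

definition minimal_prime_filter :: "'a::residuated_lattice set \<Rightarrow> 'a set \<Rightarrow> bool" where
  "minimal_prime_filter F M \<longleftrightarrow>
     prime_filter M \<and> F \<subseteq> M \<and> (\<forall>P. prime_filter P \<and> F \<subseteq> P \<and> P \<subseteq> M \<longrightarrow> P = M)"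

text \<open>The set \<open>(F : x)\<close>.\<close>

definition coann :: "'a::residuated_lattice set \<Rightarrow> 'a \<Rightarrow> 'a set" where
  "coann F x = {a. sup x a \<in> F}"

text \<open>\<open>D F H\<close> is the set \<open>D\<^sub>F(H)\<close>.\<close>

definition D :: "'a::residuated_lattice set \<Rightarrow> 'a set \<Rightarrow> 'a set" where
  "D F H = {a. \<exists>x. x \<notin> H \<and> sup x a \<in> F}"

text \<open>
  The condition concerns distinct indices, so the family \<open>x\<close> may repeat values;
  a repeated value must then itself lie in \<open>F\<close>.
\<close>

definition pairwise_in :: "'a::residuated_lattice set \<Rightarrow> nat set \<Rightarrow> (nat \<Rightarrow> 'a) \<Rightarrow> bool" where
  "pairwise_in F I x \<longleftrightarrow> pairwise (\<lambda>i j. sup (x i) (x j) \<in> F) I"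

text \<open>Intended for \<open>m \<ge> 2\<close>.\<close>

definition m_prime_filter :: "nat \<Rightarrow> 'a::residuated_lattice set \<Rightarrow> bool" where
  "m_prime_filter m Q \<longleftrightarrow>
     proper_filter Q \<and> (\<forall>x. pairwise_in Q {1..m} x \<longrightarrow> (\<exists>k\<in>{1..m}. x k \<in> Q))"

definition n_normal :: "nat \<Rightarrow> 'a::residuated_lattice set \<Rightarrow> bool" where
  "n_normal n F \<longleftrightarrow>
     (\<forall>P. prime_filter P \<and> F \<subseteq> P \<longrightarrow>
        finite {M. minimal_prime_filter F M \<and> M \<subseteq> P} \<and>
        card {M. minimal_prime_filter F M \<and> M \<subseteq> P} \<le> n)"

end

theory Submission
  imports Defs
begin

text \<open>
  All seven assertions are ways of forbidding that \<open>n + 1\<close> distinct \<open>F\<close>-minimal primes lie in a common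
  prime filter, and everything rests on two tools.

  The first is the separation of a filter from a disjoint \<open>\<squnion>\<close>-closed set by a prime filter
  (\<open>prime_filter_separation\<close>). With it, an element belongs to a join of filters as soon as it belongs
  to every prime filter above all of them, and the join is the whole algebra as soon as there is
  no such prime filter.

  The second is the identity \<open>D_eq_Inter_minimal\<close>: for prime \<open>P\<close>, the set \<open>D F P\<close> is the intersection
  of the \<open>F\<close>-minimal primes inside \<open>P\<close>. So every element outside \<open>D F P\<close> is missed by a minimal
  prime below \<open>P\<close>. Applied with \<open>P\<close> itself minimal, it shows that every element \<open>a\<close> of a minimal
  prime \<open>M\<close> satisfies \<open>x \<squnion> a \<in> F\<close> for some \<open>x \<notin> M\<close>, and from this one obtains, for any two or more,
  but finitely many, distinct minimal primes \<open>M\<^sub>i\<close>, elements \<open>x\<^sub>i \<notin> M\<^sub>i\<close> that are pairwise in \<open>F\<close>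
  (\<open>separate_minimal_primes\<close>).

  That \<open>n\<close>-normality amounts to \<open>n + 1\<close> distinct minimal primes always having the whole algebra as
  their join is then the fact that a filter is proper iff some prime contains it. It also amounts to
  each \<open>D F P\<close> being \<open>(n + 1)\<close>-prime: of \<open>n + 1\<close> elements outside \<open>D F P\<close>, each is missed by some
  minimal prime below \<open>P\<close>, so by the pigeonhole principle two of them are missed by the same
  one, which then misses their join; conversely, elements separating \<open>n + 1\<close> minimal primes below
  \<open>P\<close> are pairwise in \<open>D F P\<close>, but none belongs to it.

  The conditions on the filters \<open>coann F x\<close> follow from \<open>n\<close>-normality and imply it in a cycle.
  If a prime \<open>P\<close> above the right-hand side of the formula for the coannihilator of a join misses an
  element of the left-hand side, there are minimal primes \<open>M\<^sub>i \<subseteq> P\<close> that contain \<open>x\<^sub>i\<close> but no \<open>x\<^sub>j\<close>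
  with \<open>j \<noteq> i\<close>, hence \<open>n + 1\<close> distinct ones. When the join of the \<open>x\<^sub>i\<close> lies in \<open>F\<close>, the formula says
  that the coannihilators of the partial joins together generate the whole algebra.
  For elements pairwise in \<open>F\<close>, this is applied to the products of all \<open>x\<^sub>j\<close> but one, and shows that the
  coannihilators of the \<open>x\<^sub>i\<close> generate the whole algebra; equivalently, a product of their elements
  is \<open>0\<close>. This in turn gives \<open>n\<close>-normality: if the \<open>x\<^sub>i\<close> separate minimal primes \<open>M\<^sub>i\<close>, then
  \<open>coann F x\<^sub>i \<subseteq> M\<^sub>i\<close>, so the \<open>M\<^sub>i\<close> have no common prime above them.
\<close>

section \<open>Arithmetic of residuated lattices\<close>

lemma rl_mult_mono:
  fixes x y z w :: "'a::residuated_lattice"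
  assumes "x \<le> y" "z \<le> w"
  shows "x * z \<le> y * w"
proof -
  have r: "a * c \<le> b * c" if "a \<le> b" for a b c :: 'a
    using that residuation[of b c "b * c"] residuation[of a c "b * c"] by auto
  have "x * z \<le> y * z" using r[OF assms(1)] .
  also have "\<dots> \<le> y * w" using r[OF assms(2), of y] by (simp add: mult.commute)
  finally show ?thesis .
qed

lemma rl_mult_le_left: "x * y \<le> (x::'a::residuated_lattice)"
  using rl_mult_mono[of x x y 1] by (metis mult_1_right one_eq_top order_refl top_greatest)

text \<open>
  By residuation, products preserve joins in each argument. Expanding the left-hand side gives four
  terms, of which \<open>a * b\<close> is below \<open>sup x (a * b)\<close> directly and the others because \<open>x\<close> is a factor.
\<close>

lemma rl_sup_mult_sup_le:
  fixes x a b :: "'a::residuated_lattice"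
  shows "sup x a * sup x b \<le> sup x (a * b)"
proof -
  have 1: "x \<le> residuum (sup x b) (sup x (a * b))"
    unfolding residuation[symmetric] by (meson le_supI1 rl_mult_le_left)
  have "x * a \<le> sup x (a * b)" by (meson le_supI1 rl_mult_le_left)
  moreover have "b * a \<le> sup x (a * b)" by (simp add: mult.commute)
  ultimately have "sup x b * a \<le> sup x (a * b)"
    unfolding residuation by (rule sup_least)
  hence "a \<le> residuum (sup x b) (sup x (a * b))"
    unfolding residuation[symmetric] by (simp add: mult.commute)
  with 1 show ?thesis unfolding residuation by (rule sup_least)
qed

lemma rl_prod_le_member:
  fixes f :: "'b \<Rightarrow> 'a::residuated_lattice"
  assumes "finite I" "i \<in> I"
  shows "prod f I \<le> f i"
  using rl_mult_le_left[of "f i" "prod f (I - {i})"] prod.remove[OF assms, of f] by simp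

section \<open>Filters\<close>

lemma filter_mult: "rl_filter F \<Longrightarrow> x \<in> F \<Longrightarrow> y \<in> F \<Longrightarrow> x * y \<in> F"
  and filter_sup: "rl_filter F \<Longrightarrow> x \<in> F \<Longrightarrow> sup x y \<in> F"
  unfolding rl_filter_def by blast+

lemma filter_upward: "rl_filter F \<Longrightarrow> x \<in> F \<Longrightarrow> x \<le> y \<Longrightarrow> y \<in> F"
  by (metis filter_sup sup.absorb2)

lemma filter_one:
  assumes "rl_filter F" shows "1 \<in> F"
proof -
  obtain x where "x \<in> F" using assms unfolding rl_filter_def by blast
  thus ?thesis using filter_upward[OF assms, of x 1] by (simp add: one_eq_top)
qed

lemma rl_filterI:
  assumes "1 \<in> F" "\<And>x y. x \<in> F \<Longrightarrow> y \<in> F \<Longrightarrow> x * y \<in> F"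
    "\<And>x y. x \<in> F \<Longrightarrow> x \<le> y \<Longrightarrow> y \<in> F"
  shows "rl_filter F"
  unfolding rl_filter_def using assms sup_ge1 by blast

lemma filter_eq_UNIV_iff:
  assumes "rl_filter F" shows "F = UNIV \<longleftrightarrow> bot \<in> F"
  using filter_upward[OF assms, of bot] by auto

lemma filter_prod:
  assumes "rl_filter F" "\<And>i. i \<in> I \<Longrightarrow> f i \<in> F"
  shows "prod f I \<in> F"
  using assms(2)
  by (induction I rule: infinite_finite_induct) (auto intro: filter_one filter_mult assms(1))

lemma filter_Inter: "(\<And>F. F \<in> \<F> \<Longrightarrow> rl_filter F) \<Longrightarrow> rl_filter (\<Inter>\<F>)"
  by (rule rl_filterI) (auto intro: filter_one filter_mult dest: filter_upward)

lemma filter_filter_join: "rl_filter (filter_join \<F>)"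
  unfolding filter_join_def by (rule hull_in) (simp add: filter_Inter)

lemma filter_join_upper: "F \<in> \<F> \<Longrightarrow> F \<subseteq> filter_join \<F>"
  unfolding filter_join_def using hull_subset[of "\<Union>\<F>" rl_filter] by blast

lemma filter_join_least:
  "rl_filter G \<Longrightarrow> (\<And>F. F \<in> \<F> \<Longrightarrow> F \<subseteq> G) \<Longrightarrow> filter_join \<F> \<subseteq> G"
  unfolding filter_join_def by (rule hull_minimal) auto

lemma filter_join_image_eq:
  fixes G :: "'b \<Rightarrow> 'a::residuated_lattice set"
  assumes "finite I" and G: "\<And>i. i \<in> I \<Longrightarrow> rl_filter (G i)"
  shows "filter_join (G ` I) = {y. \<exists>a. (\<forall>i\<in>I. a i \<in> G i) \<and> prod a I \<le> y}" (is "_ = ?J")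
proof (rule antisym)
  have "rl_filter ?J"
  proof (rule rl_filterI)
    show "1 \<in> ?J" using G by (auto intro!: exI[of _ "\<lambda>_. 1"] filter_one)
  next
    fix x y assume "x \<in> ?J" "y \<in> ?J"
    then obtain a b where a: "\<forall>i\<in>I. a i \<in> G i" "prod a I \<le> x"
      and b: "\<forall>i\<in>I. b i \<in> G i" "prod b I \<le> y" by blast
    have "(\<Prod>i\<in>I. a i * b i) \<le> x * y"
      using a(2) b(2) by (simp add: prod.distrib rl_mult_mono)
    moreover have "\<forall>i\<in>I. a i * b i \<in> G i" using a(1) b(1) G by (auto intro: filter_mult)
    ultimately show "x * y \<in> ?J" by (intro CollectI exI[of _ "\<lambda>i. a i * b i"]) blast
  next
    fix x y assume "x \<in> ?J" "x \<le> y" thus "y \<in> ?J" using order_trans by blast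
  qed
  moreover have "G k \<subseteq> ?J" if k: "k \<in> I" for k
  proof
    fix y assume y: "y \<in> G k"
    let ?a = "\<lambda>i. if i = k then y else 1"
    have "prod ?a I \<le> ?a k" using assms(1) k by (rule rl_prod_le_member)
    moreover have "\<forall>i\<in>I. ?a i \<in> G i" using y G by (auto intro: filter_one)
    ultimately show "y \<in> ?J" by auto
  qed
  ultimately show "filter_join (G ` I) \<subseteq> ?J" by (intro filter_join_least) auto
next
  show "?J \<subseteq> filter_join (G ` I)"
  proof
    fix y assume "y \<in> ?J"
    then obtain a where a: "\<forall>i\<in>I. a i \<in> G i" "prod a I \<le> y" by blast
    have "prod a I \<in> filter_join (G ` I)"
      using a(1) filter_join_upper[of _ "G ` I"] by (intro filter_prod filter_filter_join) blast
    thus "y \<in> filter_join (G ` I)" using a(2) filter_filter_join filter_upward by blast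
  qed
qed

lemma filter_coann:
  assumes F: "rl_filter F" shows "rl_filter (coann F x)"
proof (rule rl_filterI)
  show "1 \<in> coann F x" using filter_one[OF F] filter_upward[OF F] by (simp add: coann_def)
  show "a * b \<in> coann F x" if "a \<in> coann F x" "b \<in> coann F x" for a b
    using that filter_upward[OF F filter_mult[OF F] rl_sup_mult_sup_le] by (simp add: coann_def)
  show "b \<in> coann F x" if "a \<in> coann F x" "a \<le> b" for a b
    using that filter_upward[OF F, of "sup x a" "sup x b"] sup_mono[of x x a b]
    by (simp add: coann_def)
qed

lemma coann_superset: "rl_filter F \<Longrightarrow> F \<subseteq> coann F x"
  unfolding coann_def using filter_upward sup_ge2 by blast

lemma coann_mono: "rl_filter F \<Longrightarrow> x \<le> y \<Longrightarrow> coann F x \<subseteq> coann F y"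
  unfolding coann_def using filter_upward sup_mono order_refl by blast

section \<open>Prime filters\<close>

lemma prime_filterD:
  assumes "prime_filter P"
  shows "rl_filter P" "P \<noteq> UNIV" "bot \<notin> P" "sup x y \<in> P \<longleftrightarrow> x \<in> P \<or> y \<in> P"
proof -
  show P: "rl_filter P" and U: "P \<noteq> UNIV"
    using assms unfolding prime_filter_def proper_filter_def by auto
  show "bot \<notin> P" using filter_eq_UNIV_iff[OF P] U by simp
  show "sup x y \<in> P \<longleftrightarrow> x \<in> P \<or> y \<in> P"
    using assms filter_upward[OF P] sup_ge1 sup_ge2 unfolding prime_filter_def by metis
qed

lemma prime_filter_Sup_fin:
  assumes "prime_filter P" "finite A" "A \<noteq> {}"
  shows "Sup_fin A \<in> P \<longleftrightarrow> (\<exists>a\<in>A. a \<in> P)"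
  using assms(2,3)
  by (induction A rule: finite_ne_induct) (auto simp: prime_filterD(4)[OF assms(1)])

lemma coann_subset_prime:
  "prime_filter P \<Longrightarrow> F \<subseteq> P \<Longrightarrow> x \<notin> P \<Longrightarrow> coann F x \<subseteq> P"
  using prime_filterD(4) by (fastforce simp: coann_def)

lemma subset_chain_linear: "subset.chain \<A> C \<Longrightarrow> X \<in> C \<Longrightarrow> Y \<in> C \<Longrightarrow> X \<subseteq> Y \<or> Y \<subseteq> X"
  unfolding subset_chain_def by blast

text \<open>
  A filter \<open>Q\<close> maximal among those disjoint from \<open>S\<close> is prime because \<open>coann Q y\<close> is again a filter
  above \<open>Q\<close>. If \<open>x \<squnion> y \<in> Q\<close> with \<open>x, y \<notin> Q\<close>, then \<open>x\<close> makes \<open>coann Q y\<close> strictly larger,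
  so it meets \<open>S\<close> in some \<open>s\<close>. Now \<open>s \<squnion> y \<in> Q\<close>, so \<open>y\<close> makes \<open>coann Q s\<close> strictly larger,
  and it meets \<open>S\<close> in some \<open>t\<close>; but then \<open>s \<squnion> t\<close> lies both in \<open>Q\<close> and in \<open>S\<close>.
\<close>

lemma prime_filter_separation:
  fixes F S :: "'a::residuated_lattice set"
  assumes F: "rl_filter F" and S: "S \<noteq> {}" "\<And>s t. s \<in> S \<Longrightarrow> t \<in> S \<Longrightarrow> sup s t \<in> S"
    and disj: "F \<inter> S = {}"
  obtains P where "prime_filter P" "F \<subseteq> P" "P \<inter> S = {}"
proof -
  let ?A = "{G. rl_filter G \<and> F \<subseteq> G \<and> G \<inter> S = {}}"
  have "\<exists>Q\<in>?A. \<forall>X\<in>?A. Q \<subseteq> X \<longrightarrow> X = Q"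
  proof (rule subset_Zorn_nonempty)
    show "?A \<noteq> {}" using F disj by blast
    fix C assume C: "C \<noteq> {}" "subset.chain ?A C"
    have CF: "rl_filter X" "F \<subseteq> X" "X \<inter> S = {}" if "X \<in> C" for X
      using that C(2) by (auto simp: subset.chain_def)
    have "rl_filter (\<Union>C)"
    proof (rule rl_filterI)
      show "1 \<in> \<Union>C" using C(1) filter_one[OF CF(1)] by auto
    next
      fix x y assume "x \<in> \<Union>C" "y \<in> \<Union>C"
      then obtain X Y where "X \<in> C" "Y \<in> C" "x \<in> X" "y \<in> Y" by blast
      moreover from this have "X \<subseteq> Y \<or> Y \<subseteq> X" using subset_chain_linear[OF C(2), of X Y] by simp
      ultimately obtain Z where "Z \<in> C" "x \<in> Z" "y \<in> Z" by blast
      thus "x * y \<in> \<Union>C" using filter_mult[OF CF(1)] by blast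
    next
      fix x y assume "x \<in> \<Union>C" "x \<le> y"
      thus "y \<in> \<Union>C" using filter_upward[OF CF(1)] by blast
    qed
    moreover have "F \<subseteq> \<Union>C" "\<Union>C \<inter> S = {}" using CF(2,3) C(1) by blast+
    ultimately show "\<Union>C \<in> ?A" by blast
  qed
  then obtain Q where QA: "Q \<in> ?A" and Qmax: "\<forall>X\<in>?A. Q \<subseteq> X \<longrightarrow> X = Q" ..
  from QA have Q: "rl_filter Q" "F \<subseteq> Q" "Q \<inter> S = {}" by simp_all
  have max: "G = Q" if G: "rl_filter G" "Q \<subseteq> G" "G \<inter> S = {}" for G
  proof -
    have "G \<in> ?A" using G order_trans[OF Q(2) G(2)] by simp
    thus ?thesis using Qmax G(2) by simp
  qed
  have grow: "\<exists>s\<in>S. sup y s \<in> Q" if "sup y x \<in> Q" "x \<notin> Q" for x y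
  proof (rule ccontr)
    assume "\<not> ?thesis"
    hence "coann Q y \<inter> S = {}" by (auto simp: coann_def)
    hence "coann Q y = Q" using max filter_coann[OF Q(1)] coann_superset[OF Q(1)] by blast
    thus False using that by (auto simp: coann_def)
  qed
  have "x \<in> Q \<or> y \<in> Q" if xy: "sup x y \<in> Q" for x y
  proof (rule ccontr)
    assume n: "\<not> ?thesis"
    then obtain s where s: "s \<in> S" "sup y s \<in> Q" using grow[of y x] xy by (auto simp: sup_commute)
    with n obtain t where "t \<in> S" "sup s t \<in> Q" using grow[of s y] by (auto simp: sup_commute)
    thus False using S(2) s(1) Q(3) by blast
  qed
  hence "prime_filter Q" using Q S(1) unfolding prime_filter_def proper_filter_def by blast
  thus thesis using that Q by blast
qed

lemma prime_filter_avoiding_element: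
  assumes "rl_filter F" "a \<notin> F"
  obtains P where "prime_filter P" "F \<subseteq> P" "a \<notin> P"
  using prime_filter_separation[of F "{a}"] assms by auto

section \<open>Minimal prime filters\<close>

text \<open>
  The order is reversed by passing to complements, so that Zorn's lemma for inclusion applies and
  chains of primes are closed under intersection.
\<close>

lemma minimal_prime_below:
  assumes P: "prime_filter P" "F \<subseteq> P"
  obtains M where "minimal_prime_filter F M" "M \<subseteq> P"
proof -
  let ?A = "{S. prime_filter (- S) \<and> F \<subseteq> - S \<and> - S \<subseteq> P}"
  have "\<exists>Q\<in>?A. \<forall>X\<in>?A. Q \<subseteq> X \<longrightarrow> X = Q"
  proof (rule subset_Zorn_nonempty)
    show "?A \<noteq> {}" using P by (auto intro!: exI[of _ "- P"])
    fix C assume C: "C \<noteq> {}" "subset.chain ?A C"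
    have CP: "prime_filter (- S)" "F \<subseteq> - S" "- S \<subseteq> P" if "S \<in> C" for S
      using that C(2) by (auto simp: subset.chain_def)
    have "rl_filter (- \<Union>C)"
      unfolding uminus_Sup by (rule filter_Inter) (auto intro: prime_filterD(1)[OF CP(1)])
    moreover have "- \<Union>C \<subseteq> P" "F \<subseteq> - \<Union>C" using CP(2,3) C(1) by blast+
    moreover have "- \<Union>C \<noteq> UNIV" using \<open>- \<Union>C \<subseteq> P\<close> prime_filterD(2)[OF P(1)] by blast
    moreover have "x \<in> - \<Union>C \<or> y \<in> - \<Union>C" if xy: "sup x y \<in> - \<Union>C" for x y
    proof (rule ccontr)
      assume "\<not> ?thesis"
      then obtain X Y where "X \<in> C" "Y \<in> C" "x \<in> X" "y \<in> Y" by blast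
      moreover from this have "X \<subseteq> Y \<or> Y \<subseteq> X" using subset_chain_linear[OF C(2), of X Y] by simp
      ultimately obtain Z where Z: "Z \<in> C" "x \<in> Z" "y \<in> Z" by blast
      hence "sup x y \<in> Z" using prime_filterD(4)[OF CP(1)[OF Z(1)], of x y] by simp
      thus False using xy Z(1) by blast
    qed
    ultimately show "\<Union>C \<in> ?A" unfolding prime_filter_def proper_filter_def by blast
  qed
  then obtain Q where QA: "Q \<in> ?A" and max: "\<forall>X\<in>?A. Q \<subseteq> X \<longrightarrow> X = Q" ..
  from QA have Q: "prime_filter (- Q)" "F \<subseteq> - Q" "- Q \<subseteq> P" by simp_all
  have "R = - Q" if R: "prime_filter R" "F \<subseteq> R" "R \<subseteq> - Q" for R
  proof -
    have "- R \<in> ?A" using R order_trans[OF R(3) Q(3)] by simp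
    moreover have "Q \<subseteq> - R" using R(3) by blast
    ultimately have "- R = Q" using max by simp
    thus ?thesis by blast
  qed
  hence "minimal_prime_filter F (- Q)" unfolding minimal_prime_filter_def using Q by blast
  thus thesis using that Q(3) by blast
qed

lemma minimal_prime_filterD:
  assumes "minimal_prime_filter F M"
  shows "prime_filter M" "F \<subseteq> M" "\<And>P. prime_filter P \<Longrightarrow> F \<subseteq> P \<Longrightarrow> P \<subseteq> M \<Longrightarrow> P = M"
  using assms unfolding minimal_prime_filter_def by auto

text \<open>
  Given \<open>a \<notin> D F P\<close>, the elements below some \<open>x \<squnion> a\<close> with \<open>x \<notin> P\<close> form a \<open>\<squnion>\<close>-closed set disjoint
  from \<open>F\<close>. It contains both \<open>a\<close> and the complement of \<open>P\<close>, so a prime filter separating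
  it from \<open>F\<close> misses \<open>a\<close> and lies inside \<open>P\<close>.
\<close>

lemma D_eq_Inter_minimal:
  assumes F: "rl_filter F" and P: "prime_filter P"
  shows "D F P = \<Inter>{M. minimal_prime_filter F M \<and> M \<subseteq> P}" (is "_ = ?I")
proof (rule antisym)
  show "D F P \<subseteq> ?I"
    using prime_filterD(4) minimal_prime_filterD(1,2) by (fastforce simp: D_def)
next
  show "?I \<subseteq> D F P"
  proof (rule ccontr)
    assume "\<not> ?thesis"
    then obtain a where a: "a \<in> ?I" "a \<notin> D F P" by blast
    let ?S = "{y. \<exists>x. x \<notin> P \<and> y \<le> sup x a}"
    have aS: "a \<in> ?S" using prime_filterD(3)[OF P] by auto
    have PS: "- P \<subseteq> ?S" by auto
    have "sup s t \<in> ?S" if st: "s \<in> ?S" "t \<in> ?S" for s t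
    proof -
      obtain x y where "x \<notin> P" "s \<le> sup x a" "y \<notin> P" "t \<le> sup y a" using st by blast
      moreover from this have "sup s t \<le> sup (sup x y) a"
        using sup_mono[of s "sup x a" t "sup y a"] by (simp add: ac_simps)
      ultimately have "sup x y \<notin> P" "sup s t \<le> sup (sup x y) a"
        using prime_filterD(4)[OF P] by auto
      thus ?thesis by blast
    qed
    moreover have "F \<inter> ?S = {}" using a(2) filter_upward[OF F] by (auto simp: D_def)
    ultimately obtain Q where Q: "prime_filter Q" "F \<subseteq> Q" "Q \<inter> ?S = {}"
      using prime_filter_separation[OF F, of ?S] aS by blast
    then obtain M where M: "minimal_prime_filter F M" "M \<subseteq> Q" using minimal_prime_below by blast
    hence "M \<subseteq> P" using Q(3) PS by blast
    hence "a \<in> M" using M a(1) by blast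
    thus False using M(2) Q(3) aS by blast
  qed
qed

lemma proper_filter_D:
  assumes F: "rl_filter F" and P: "prime_filter P" "F \<subseteq> P"
  shows "proper_filter (D F P)"
proof -
  obtain M where M: "minimal_prime_filter F M" "M \<subseteq> P" using P minimal_prime_below by blast
  have "rl_filter (D F P)"
    unfolding D_eq_Inter_minimal[OF F P(1)]
    by (rule filter_Inter) (auto intro: minimal_prime_filterD(1) prime_filterD(1))
  moreover have "bot \<notin> D F P"
    using M prime_filterD(3)[OF minimal_prime_filterD(1)] D_eq_Inter_minimal[OF F P(1)] by blast
  ultimately show ?thesis unfolding proper_filter_def by auto
qed

lemma minimal_prime_witness:
  assumes F: "rl_filter F" and M: "minimal_prime_filter F M" and a: "a \<in> M"
  obtains c where "c \<notin> M" "sup c a \<in> F"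
proof -
  have "{N. minimal_prime_filter F N \<and> N \<subseteq> M} = {M}"
    using M unfolding minimal_prime_filter_def by blast
  hence "D F M = M" using D_eq_Inter_minimal[OF F minimal_prime_filterD(1)[OF M]] by simp
  thus thesis using a that by (auto simp: D_def)
qed

text \<open>
  For \<open>i \<noteq> j\<close> an element \<open>a\<close> of \<open>M i - M j\<close> comes with some \<open>c \<notin> M i\<close> such that \<open>c \<squnion> a \<in> F\<close>.
  For each \<open>i\<close>, the join of all the elements so obtained that lie outside \<open>M i\<close> (one \<open>c\<close> and one \<open>a\<close>
  for each of the other indices) is still outside \<open>M i\<close>, by primality. Any two of these joins
  together lie above some \<open>c \<squnion> a\<close>, hence their join is in \<open>F\<close>.
\<close>

lemma separate_minimal_primes:
  fixes F :: "'a::residuated_lattice set"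
  assumes F: "rl_filter F" and I: "finite I" "\<And>i. i \<in> I \<Longrightarrow> I - {i} \<noteq> {}"
    and inj: "inj_on M I" and M: "\<And>i. i \<in> I \<Longrightarrow> minimal_prime_filter F (M i)"
  obtains x where "pairwise_in F I x" "\<And>i. i \<in> I \<Longrightarrow> x i \<notin> M i"
proof -
  have "\<exists>c a. c \<notin> M i \<and> a \<notin> M j \<and> sup c a \<in> F" if ij: "i \<in> I" "j \<in> I" "i \<noteq> j" for i j
  proof -
    have "M i \<noteq> M j" using inj ij by (auto simp: inj_on_def)
    hence "\<not> M i \<subseteq> M j"
      using minimal_prime_filterD(3)[OF M[OF ij(2)]] minimal_prime_filterD(1,2)[OF M[OF ij(1)]]
      by blast
    then obtain a where a: "a \<in> M i" "a \<notin> M j" by blast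
    then obtain c where "c \<notin> M i" "sup c a \<in> F"
      using minimal_prime_witness[OF F M[OF ij(1)]] by blast
    thus ?thesis using a by blast
  qed
  then obtain c a where ca: "\<And>i j. i \<in> I \<Longrightarrow> j \<in> I \<Longrightarrow> i \<noteq> j \<Longrightarrow>
      c i j \<notin> M i \<and> a i j \<notin> M j \<and> sup (c i j) (a i j) \<in> F" by metis
  define x where "x i = Sup_fin ((\<lambda>j. sup (c i j) (a j i)) ` (I - {i}))" for i
  have le: "sup (c i j) (a j i) \<le> x i" if "j \<in> I" "j \<noteq> i" for i j
    unfolding x_def using that I(1) by (intro Sup_fin.coboundedI) auto
  have "x i \<notin> M i" if i: "i \<in> I" for i
  proof -
    have Mi: "prime_filter (M i)" using M[OF i] minimal_prime_filterD(1) by blast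
    have "sup (c i j) (a j i) \<notin> M i" if "j \<in> I - {i}" for j
      using prime_filterD(4)[OF Mi] ca[OF i, of j] ca[OF _ i, of j] that by auto
    thus ?thesis unfolding x_def
      using prime_filter_Sup_fin[OF Mi, of "(\<lambda>j. sup (c i j) (a j i)) ` (I - {i})"] I(1) I(2)[OF i]
      by blast
  qed
  moreover have "sup (x i) (x j) \<in> F" if ij: "i \<in> I" "j \<in> I" "i \<noteq> j" for i j
  proof -
    have "c i j \<le> x i" "a i j \<le> x j" using le[of j i] le[of i j] ij by auto
    thus ?thesis using ca[OF ij] filter_upward[OF F] sup_mono by blast
  qed
  ultimately show thesis using that unfolding pairwise_in_def pairwise_def by blast
qed

section \<open>Families of minimal primes below a prime\<close>

lemma n_normalI:
  assumes "\<And>P M. prime_filter P \<Longrightarrow> F \<subseteq> P \<Longrightarrow> inj_on M {0..n} \<Longrightarrow>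
    (\<And>i. i \<in> {0..n} \<Longrightarrow> minimal_prime_filter F (M i)) \<Longrightarrow>
    (\<And>i. i \<in> {0..n} \<Longrightarrow> M i \<subseteq> P) \<Longrightarrow> False"
  shows "n_normal n F"
  unfolding n_normal_def
proof (intro allI impI)
  fix P assume P: "prime_filter P \<and> F \<subseteq> P"
  let ?S = "{M. minimal_prime_filter F M \<and> M \<subseteq> P}"
  show "finite ?S \<and> card ?S \<le> n"
  proof (rule ccontr)
    assume "\<not> ?thesis"
    hence "infinite ?S \<or> Suc n \<le> card ?S" by auto
    then obtain T where T: "T \<subseteq> ?S" "finite T" "card T = Suc n"
    proof
      assume "infinite ?S"
      thus thesis using infinite_arbitrarily_large[of ?S "Suc n"] that by blast
    next
      assume "Suc n \<le> card ?S"
      then obtain T where "T \<subseteq> ?S" "card T = Suc n" "finite T"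
        by (rule obtain_subset_with_card_n)
      thus thesis by (intro that)
    qed
    obtain M where "bij_betw M {0..<Suc n} T" using ex_bij_betw_nat_finite[OF T(2)] T(3) by auto
    hence M: "inj_on M {0..n}" "M ` {0..n} = T"
      by (auto simp: bij_betw_def atLeastLessThanSuc_atLeastAtMost)
    show False
    proof (rule assms)
      show "prime_filter P" "F \<subseteq> P" "inj_on M {0..n}" using P M(1) by auto
      show "minimal_prime_filter F (M i)" "M i \<subseteq> P" if "i \<in> {0..n}" for i
        using that M(2) T(1) by blast+
    qed
  qed
qed

lemma n_normal_pigeonhole:
  assumes N: "n_normal n F" and P: "prime_filter P" "F \<subseteq> P" and I: "n < card I"
    and M: "\<And>i. i \<in> I \<Longrightarrow> minimal_prime_filter F (M i)" "\<And>i. i \<in> I \<Longrightarrow> M i \<subseteq> P"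
  obtains i j where "i \<in> I" "j \<in> I" "i \<noteq> j" "M i = M j"
proof -
  let ?S = "{M. minimal_prime_filter F M \<and> M \<subseteq> P}"
  have S: "finite ?S" "card ?S \<le> n" using N P unfolding n_normal_def by blast+
  have "M ` I \<subseteq> ?S" using M by blast
  hence "card (M ` I) < card I" using card_mono[OF S(1), of "M ` I"] S(2) I by linarith
  hence "\<not> inj_on M I" using card_image[of M I] by linarith
  thus thesis using that by (auto simp: inj_on_def)
qed

section \<open>The equivalences\<close>

lemma n_normal_iff_join_minimal_primes:
  fixes F :: "'a::residuated_lattice set"
  shows "(\<forall>M. inj_on M {0..n} \<and> (\<forall>i\<in>{0..n}. minimal_prime_filter F (M i)) \<longrightarrow>
         filter_join (M ` {0..n}) = UNIV) \<longleftrightarrow> n_normal n F" (is "?J \<longleftrightarrow> _")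
proof
  assume J: ?J
  show "n_normal n F"
  proof (rule n_normalI)
    fix P :: "'a set" and M
    assume P: "prime_filter P" and M: "inj_on M {0..n}"
      "\<And>i. i \<in> {0..n} \<Longrightarrow> minimal_prime_filter F (M i)" "\<And>i. i \<in> {0..n} \<Longrightarrow> M i \<subseteq> P"
    have "filter_join (M ` {0..n}) \<subseteq> P"
      using M(3) by (intro filter_join_least prime_filterD(1)[OF P]) blast
    thus False using J M(1,2) prime_filterD(2)[OF P] by blast
  qed
next
  assume N: "n_normal n F"
  show ?J
  proof (intro allI impI, rule ccontr)
    fix M
    assume M: "inj_on M {0..n} \<and> (\<forall>i\<in>{0..n}. minimal_prime_filter F (M i))"
      and "filter_join (M ` {0..n}) \<noteq> UNIV"
    then obtain P where P: "prime_filter P" "filter_join (M ` {0..n}) \<subseteq> P"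
      by (metis UNIV_eq_I filter_filter_join prime_filter_avoiding_element)
    hence MP: "M i \<subseteq> P" if "i \<in> {0..n}" for i
      using filter_join_upper[of "M i" "M ` {0..n}"] that by blast
    have "minimal_prime_filter F (M 0)" "M 0 \<subseteq> P" using M MP by auto
    hence "F \<subseteq> P" using minimal_prime_filterD(2) by blast
    then obtain i j where "i \<in> {0..n}" "j \<in> {0..n}" "i \<noteq> j" "M i = M j"
      using n_normal_pigeonhole[OF N P(1), of "{0..n}" M] M MP by auto
    thus False using M by (auto simp: inj_on_def)
  qed
qed

text \<open>
  In one direction, two of the \<open>n + 1\<close> elements are missed by the same minimal prime below \<open>P\<close>, and so
  is their join. In the other, elements separating \<open>n + 1\<close> minimal primes below \<open>P\<close> contradict
  \<open>(n + 1)\<close>-primality, as they are pairwise in \<open>F \<subseteq> D F P\<close>.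
\<close>

lemma n_normal_iff_m_prime_D:
  fixes F :: "'a::residuated_lattice set"
  assumes F: "rl_filter F" and n: "n \<ge> 1"
  shows "n_normal n F \<longleftrightarrow> (\<forall>P. prime_filter P \<and> F \<subseteq> P \<longrightarrow> m_prime_filter (n + 1) (D F P))"
    (is "_ \<longleftrightarrow> ?D")
proof
  assume N: "n_normal n F"
  show ?D
  proof (intro allI impI)
    fix P assume "prime_filter P \<and> F \<subseteq> P"
    hence P: "prime_filter P" "F \<subseteq> P" by auto
    have "\<exists>k\<in>{1..n + 1}. x k \<in> D F P" if x: "pairwise_in (D F P) {1..n + 1} x" for x
    proof (rule ccontr)
      assume "\<not> ?thesis"
      hence "\<forall>k\<in>{1..n + 1}. \<exists>M. minimal_prime_filter F M \<and> M \<subseteq> P \<and> x k \<notin> M"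
        unfolding D_eq_Inter_minimal[OF F P(1)] by blast
      then obtain M where M: "\<And>k. k \<in> {1..n + 1} \<Longrightarrow> minimal_prime_filter F (M k)"
        "\<And>k. k \<in> {1..n + 1} \<Longrightarrow> M k \<subseteq> P" "\<And>k. k \<in> {1..n + 1} \<Longrightarrow> x k \<notin> M k" by metis
      obtain i j where ij: "i \<in> {1..n + 1}" "j \<in> {1..n + 1}" "i \<noteq> j" "M i = M j"
        by (rule n_normal_pigeonhole[OF N P _ M(1,2), of "{1..n + 1}"]) auto
      have "sup (x i) (x j) \<in> D F P" using x ij by (auto simp: pairwise_in_def pairwise_def)
      hence "sup (x i) (x j) \<in> M i"
        unfolding D_eq_Inter_minimal[OF F P(1)] using M(1,2) ij(1) by blast
      hence "x i \<in> M i \<or> x j \<in> M j"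
        using prime_filterD(4)[OF minimal_prime_filterD(1)[OF M(1)[OF ij(1)]]] ij(4) by simp
      thus False using M(3) ij(1,2) by blast
    qed
    thus "m_prime_filter (n + 1) (D F P)"
      using proper_filter_D[OF F P] unfolding m_prime_filter_def by blast
  qed
next
  assume D: ?D
  show "n_normal n F"
  proof (rule n_normalI)
    fix P :: "'a set" and M
    assume P: "prime_filter P" "F \<subseteq> P" and M: "inj_on M {0..n}"
      "\<And>i. i \<in> {0..n} \<Longrightarrow> minimal_prime_filter F (M i)" "\<And>i. i \<in> {0..n} \<Longrightarrow> M i \<subseteq> P"
    have ne: "{0..n} - {i} \<noteq> {}" for i using n by (cases "i = 0") auto
    obtain x where x: "pairwise_in F {0..n} x" "\<And>i. i \<in> {0..n} \<Longrightarrow> x i \<notin> M i"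
      using separate_minimal_primes[OF F _ ne M(1,2)] by blast
    have "F \<subseteq> D F P" using filter_upward[OF F _ sup_ge2] prime_filterD(3)[OF P(1)]
      by (auto simp: D_def)
    \<comment> \<open>The definition of an \<open>m\<close>-prime filter counts its elements from 1.\<close>
    moreover have "sup (x (i - 1)) (x (j - 1)) \<in> F"
      if "i \<in> {1..n + 1}" "j \<in> {1..n + 1}" "i \<noteq> j" for i j
      using x(1) that by (auto simp: pairwise_in_def pairwise_def)
    ultimately have "pairwise_in (D F P) {1..n + 1} (\<lambda>k. x (k - 1))"
      by (auto simp: pairwise_in_def pairwise_def)
    then obtain k where k: "k \<in> {1..n + 1}" "x (k - 1) \<in> D F P"
      using D P unfolding m_prime_filter_def by blast
    hence k': "k - 1 \<in> {0..n}" by auto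
    have "x (k - 1) \<in> M (k - 1)"
      using k(2) M(2,3)[OF k'] unfolding D_eq_Inter_minimal[OF F P(1)] by blast
    thus False using x(2)[OF k'] by blast
  qed
qed

text \<open>
  Let \<open>s i\<close> be the join of the \<open>x j\<close> with \<open>j \<noteq> i\<close>, and let \<open>P\<close> be a prime above all \<open>coann F (s i)\<close> that
  misses some \<open>a\<close> with \<open>s i \<squnion> x i \<squnion> a \<in> F\<close>. Then \<open>s i \<squnion> a\<close> is outside \<open>D F P\<close>: if \<open>y \<squnion> s i \<squnion> a \<in> F\<close>,
  then \<open>y \<squnion> a \<in> coann F (s i) \<subseteq> P\<close> and so \<open>y \<in> P\<close>. This yields a minimal prime \<open>M i \<subseteq> P\<close> missing
  \<open>s i\<close> and \<open>a\<close>, which must then contain \<open>x i\<close>; such \<open>M i\<close> are distinct for distinct \<open>i\<close>.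
\<close>

lemma n_normal_imp_coann_Sup_fin:
  fixes F :: "'a::residuated_lattice set" and x :: "nat \<Rightarrow> 'a"
  assumes F: "rl_filter F" and n: "n \<ge> 1" and N: "n_normal n F"
  shows "coann F (Sup_fin (x ` {0..n})) =
         filter_join ((\<lambda>i. coann F (Sup_fin (x ` ({0..n} - {i})))) ` {0..n})"
    (is "_ = filter_join (?G ` _)")
proof (rule antisym)
  have ne: "{0..n} - {i} \<noteq> {}" for i using n by (cases "i = 0") auto
  let ?s = "\<lambda>i. Sup_fin (x ` ({0..n} - {i}))"
  show "filter_join (?G ` {0..n}) \<subseteq> coann F (Sup_fin (x ` {0..n}))"
  proof (rule filter_join_least[OF filter_coann[OF F]])
    fix H assume "H \<in> ?G ` {0..n}"
    then obtain i where i: "H = ?G i" by blast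
    show "H \<subseteq> coann F (Sup_fin (x ` {0..n}))" unfolding i
      by (intro coann_mono[OF F] Sup_fin.subset_imp) (use ne[of i] in auto)
  qed
  show "coann F (Sup_fin (x ` {0..n})) \<subseteq> filter_join (?G ` {0..n})"
  proof (rule ccontr)
    assume "\<not> ?thesis"
    then obtain a where a: "sup (Sup_fin (x ` {0..n})) a \<in> F" "a \<notin> filter_join (?G ` {0..n})"
      by (auto simp: coann_def)
    then obtain P where P: "prime_filter P" "filter_join (?G ` {0..n}) \<subseteq> P" "a \<notin> P"
      using prime_filter_avoiding_element[OF filter_filter_join] by blast
    have GP: "?G i \<subseteq> P" if "i \<in> {0..n}" for i
      using P(2) filter_join_upper[of "?G i" "?G ` {0..n}"] that by blast
    have FP: "F \<subseteq> P" using GP[of 0] coann_superset[OF F] by fastforce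
    have "sup (?s i) a \<notin> D F P" if i: "i \<in> {0..n}" for i
    proof
      assume "sup (?s i) a \<in> D F P"
      then obtain y where y: "y \<notin> P" "sup y (sup (?s i) a) \<in> F" by (auto simp: D_def)
      hence "sup y a \<in> ?G i" by (simp add: coann_def sup.left_commute)
      hence "sup y a \<in> P" using GP[OF i] by blast
      thus False using y(1) P(3) prime_filterD(4)[OF P(1)] by blast
    qed
    hence "\<forall>i\<in>{0..n}. \<exists>M. minimal_prime_filter F M \<and> M \<subseteq> P \<and> sup (?s i) a \<notin> M"
      unfolding D_eq_Inter_minimal[OF F P(1)] by blast
    then obtain M where M: "\<And>i. i \<in> {0..n} \<Longrightarrow> minimal_prime_filter F (M i)"
        "\<And>i. i \<in> {0..n} \<Longrightarrow> M i \<subseteq> P" "\<And>i. i \<in> {0..n} \<Longrightarrow> sup (?s i) a \<notin> M i" by metis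
    obtain i j where ij: "i \<in> {0..n}" "j \<in> {0..n}" "i \<noteq> j" "M i = M j"
      by (rule n_normal_pigeonhole[OF N P(1) FP _ M(1,2), of "{0..n}"]) auto
    \<comment> \<open>Since \<open>i \<noteq> j\<close>, the prime \<open>M i = M j\<close> misses \<open>a\<close> and every \<open>x l\<close>, yet contains their join.\<close>
    have pr: "prime_filter (M k)" if "k \<in> {0..n}" for k
      using M(1)[OF that] minimal_prime_filterD(1) by blast
    have miss: "a \<notin> M k \<and> (\<forall>l\<in>{0..n} - {k}. x l \<notin> M k)" if k: "k \<in> {0..n}" for k
      using M(3)[OF k] prime_filterD(4)[OF pr[OF k]]
        prime_filter_Sup_fin[OF pr[OF k], of "x ` ({0..n} - {k})"] ne[of k] by blast
    have "sup (Sup_fin (x ` {0..n})) a \<in> M i"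
      using a(1) minimal_prime_filterD(2)[OF M(1)[OF ij(1)]] by blast
    hence "Sup_fin (x ` {0..n}) \<in> M i"
      using prime_filterD(4)[OF pr[OF ij(1)]] miss[OF ij(1)] by blast
    then obtain l where "l \<in> {0..n}" "x l \<in> M i"
      using prime_filter_Sup_fin[OF pr[OF ij(1)], of "x ` {0..n}"] by auto
    thus False using miss[OF ij(1)] miss[OF ij(2)] ij(3,4) by auto
  qed
qed

text \<open>
  The instance to use is \<open>y i = (\<Prod>j \<noteq> i. x j)\<close>. A prime filter above \<open>F\<close> misses at most one of the \<open>x i\<close>
  and so contains some \<open>y i\<close>; hence the join of the \<open>y i\<close> is in \<open>F\<close>. And every \<open>y j\<close> with \<open>j \<noteq> i\<close> has
  \<open>x i\<close> as a factor, so their join is below \<open>x i\<close>.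
\<close>

lemma Sup_fin_condition_imp_join_coann:
  fixes F :: "'a::residuated_lattice set" and x :: "nat \<Rightarrow> 'a"
  assumes F: "rl_filter F" and n: "n \<ge> 1"
    and S: "\<And>y :: nat \<Rightarrow> 'a. Sup_fin (y ` {0..n}) \<in> F \<Longrightarrow>
         filter_join ((\<lambda>i. coann F (Sup_fin (y ` ({0..n} - {i})))) ` {0..n}) = UNIV"
    and x: "pairwise_in F {0..n} x"
  shows "filter_join ((\<lambda>i. coann F (x i)) ` {0..n}) = UNIV"
proof -
  have ne: "{0..n} - {i} \<noteq> {}" for i using n by (cases "i = 0") auto
  define y where "y i = prod x ({0..n} - {i})" for i
  have "Sup_fin (y ` {0..n}) \<in> F"
  proof (rule ccontr)
    assume "Sup_fin (y ` {0..n}) \<notin> F"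
    then obtain P where P: "prime_filter P" "F \<subseteq> P" "Sup_fin (y ` {0..n}) \<notin> P"
      using prime_filter_avoiding_element[OF F] by blast
    hence yP: "y i \<notin> P" if "i \<in> {0..n}" for i
      using prime_filter_Sup_fin[OF P(1), of "y ` {0..n}"] that by blast
    have ex: "\<exists>j\<in>{0..n} - {i}. x j \<notin> P" if "i \<in> {0..n}" for i
      using filter_prod[OF prime_filterD(1)[OF P(1)], of "{0..n} - {i}" x] yP[OF that]
      unfolding y_def by blast
    obtain i where i: "i \<in> {0..n}" "x i \<notin> P" using ex[of 0] by fastforce
    obtain j where j: "j \<in> {0..n} - {i}" "x j \<notin> P" using ex[OF i(1)] by blast
    have "sup (x i) (x j) \<in> P" using x i j P(2) by (auto simp: pairwise_in_def pairwise_def)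
    thus False using i j prime_filterD(4)[OF P(1)] by blast
  qed
  hence "filter_join ((\<lambda>i. coann F (Sup_fin (y ` ({0..n} - {i})))) ` {0..n}) = UNIV" by (rule S)
  moreover have "filter_join ((\<lambda>i. coann F (Sup_fin (y ` ({0..n} - {i})))) ` {0..n})
      \<subseteq> filter_join ((\<lambda>i. coann F (x i)) ` {0..n})"
  proof (rule filter_join_least[OF filter_filter_join])
    fix H assume "H \<in> (\<lambda>i. coann F (Sup_fin (y ` ({0..n} - {i})))) ` {0..n}"
    then obtain i where i: "i \<in> {0..n}" "H = coann F (Sup_fin (y ` ({0..n} - {i})))" by blast
    have "Sup_fin (y ` ({0..n} - {i})) \<le> x i"
    proof (rule Sup_fin.boundedI)
      fix b assume "b \<in> y ` ({0..n} - {i})"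
      then obtain j where "j \<in> {0..n} - {i}" "b = y j" by blast
      thus "b \<le> x i" using rl_prod_le_member[of "{0..n} - {j}" i x] i(1) by (auto simp: y_def)
    qed (use ne[of i] in auto)
    hence "H \<subseteq> coann F (x i)" unfolding i(2) by (rule coann_mono[OF F])
    also have "\<dots> \<subseteq> filter_join ((\<lambda>i. coann F (x i)) ` {0..n})"
      using i(1) by (intro filter_join_upper) blast
    finally show "H \<subseteq> filter_join ((\<lambda>i. coann F (x i)) ` {0..n})" .
  qed
  ultimately show ?thesis by blast
qed

text \<open>
  If \<open>x i \<notin> M i\<close> then \<open>coann F (x i) \<subseteq> M i\<close>, so a prime above all the \<open>M i\<close> would contain the join of
  the \<open>coann F (x i)\<close>.
\<close>

lemma join_coann_imp_n_normal:
  fixes F :: "'a::residuated_lattice set"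
  assumes F: "rl_filter F" and n: "n \<ge> 1"
    and J: "\<And>x. pairwise_in F {0..n} x \<Longrightarrow> filter_join ((\<lambda>i. coann F (x i)) ` {0..n}) = UNIV"
  shows "n_normal n F"
proof (rule n_normalI)
  fix P :: "'a set" and M
  assume P: "prime_filter P" "F \<subseteq> P" and M: "inj_on M {0..n}"
    "\<And>i. i \<in> {0..n} \<Longrightarrow> minimal_prime_filter F (M i)" "\<And>i. i \<in> {0..n} \<Longrightarrow> M i \<subseteq> P"
  have ne: "{0..n} - {i} \<noteq> {}" for i using n by (cases "i = 0") auto
  obtain x where x: "pairwise_in F {0..n} x" "\<And>i. i \<in> {0..n} \<Longrightarrow> x i \<notin> M i"
    using separate_minimal_primes[OF F _ ne M(1,2)] by blast
  have "coann F (x i) \<subseteq> P" if i: "i \<in> {0..n}" for i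
    using coann_subset_prime[of "M i" F "x i"] minimal_prime_filterD(1,2)[OF M(2)[OF i]]
      x(2)[OF i] M(3)[OF i] by blast
  hence "filter_join ((\<lambda>i. coann F (x i)) ` {0..n}) \<subseteq> P"
    by (intro filter_join_least prime_filterD(1)[OF P(1)]) blast
  thus False using J[OF x(1)] prime_filterD(2)[OF P(1)] by blast
qed

lemma join_coann_eq_UNIV_iff_prod_bot:
  fixes F :: "'a::residuated_lattice set"
  assumes F: "rl_filter F" and I: "finite I"
  shows "filter_join ((\<lambda>i. coann F (x i)) ` I) = UNIV \<longleftrightarrow>
    (\<exists>a. (\<forall>i\<in>I. a i \<in> coann F (x i)) \<and> prod a I = bot)"
  unfolding filter_eq_UNIV_iff[OF filter_filter_join]
  unfolding filter_join_image_eq[OF I, of "\<lambda>i. coann F (x i)", OF filter_coann[OF F]]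
  by (simp add: bot_unique)

theorem proposition4p5:
  fixes F :: "'a::residuated_lattice set" and n :: nat
  assumes "rl_filter F" and "n \<ge> 1"
  shows
    "((\<forall>M. inj_on M {0..n} \<and> (\<forall>i\<in>{0..n}. minimal_prime_filter F (M i)) \<longrightarrow>
         filter_join (M ` {0..n}) = UNIV)
      \<longleftrightarrow> n_normal n F) \<and>
     (n_normal n F \<longleftrightarrow>
      (\<forall>P. prime_filter P \<and> F \<subseteq> P \<longrightarrow> m_prime_filter (n + 1) (D F P))) \<and>
     (n_normal n F \<longleftrightarrow>
      (\<forall>x. pairwise_in F {0..n} x \<longrightarrow>
         filter_join ((\<lambda>i. coann F (x i)) ` {0..n}) = UNIV)) \<and>
     (n_normal n F \<longleftrightarrow>
      (\<forall>x. pairwise_in F {0..n} x \<longrightarrow>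
         (\<exists>a. (\<forall>i\<in>{0..n}. a i \<in> coann F (x i)) \<and> (\<Prod>i=0..n. a i) = bot))) \<and>
     (n_normal n F \<longleftrightarrow>
      (\<forall>x :: nat \<Rightarrow> 'a. coann F (Sup_fin (x ` {0..n})) =
         filter_join ((\<lambda>i. coann F (Sup_fin (x ` ({0..n} - {i})))) ` {0..n}))) \<and>
     (n_normal n F \<longleftrightarrow>
      (\<forall>x :: nat \<Rightarrow> 'a. Sup_fin (x ` {0..n}) \<in> F \<longrightarrow>
         filter_join ((\<lambda>i. coann F (Sup_fin (x ` ({0..n} - {i})))) ` {0..n}) = UNIV))"
proof -
  let ?formula = "\<forall>x :: nat \<Rightarrow> 'a. coann F (Sup_fin (x ` {0..n})) =
         filter_join ((\<lambda>i. coann F (Sup_fin (x ` ({0..n} - {i})))) ` {0..n})"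
  let ?condition = "\<forall>x :: nat \<Rightarrow> 'a. Sup_fin (x ` {0..n}) \<in> F \<longrightarrow>
         filter_join ((\<lambda>i. coann F (Sup_fin (x ` ({0..n} - {i})))) ` {0..n}) = UNIV"
  let ?join = "\<forall>x. pairwise_in F {0..n} x \<longrightarrow>
         filter_join ((\<lambda>i. coann F (x i)) ` {0..n}) = UNIV"
  note F = assms(1) and n = assms(2)
  have formula: ?formula if "n_normal n F"
    using n_normal_imp_coann_Sup_fin[OF F n that] by blast
  have condition: ?condition if ?formula
  proof (intro allI impI)
    fix x :: "nat \<Rightarrow> 'a" assume "Sup_fin (x ` {0..n}) \<in> F"
    hence "coann F (Sup_fin (x ` {0..n})) = UNIV"
      using filter_sup[OF F] by (auto simp: coann_def)
    thus "filter_join ((\<lambda>i. coann F (Sup_fin (x ` ({0..n} - {i})))) ` {0..n}) = UNIV"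
      using that by metis
  qed
  have join: ?join if ?condition
    using Sup_fin_condition_imp_join_coann[OF F n] that by blast
  have normal: "n_normal n F" if ?join
    using join_coann_imp_n_normal[OF F n] that by blast
  have iff_join: "n_normal n F \<longleftrightarrow> ?join" using formula condition join normal by blast
  have iff_prod: "n_normal n F \<longleftrightarrow>
      (\<forall>x. pairwise_in F {0..n} x \<longrightarrow>
         (\<exists>a. (\<forall>i\<in>{0..n}. a i \<in> coann F (x i)) \<and> (\<Prod>i=0..n. a i) = bot))"
    unfolding iff_join join_coann_eq_UNIV_iff_prod_bot[OF F finite_atLeastAtMost] ..
  have iff_formula: "n_normal n F \<longleftrightarrow> ?formula" using formula condition join normal by blast
  have iff_condition: "n_normal n F \<longleftrightarrow> ?condition" using formula condition join normal by blast
  show ?thesis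
    by (intro conjI n_normal_iff_join_minimal_primes n_normal_iff_m_prime_D[OF F n]
        iff_join iff_prod iff_formula iff_condition)
qed

end
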